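(* Let $q$ be a power of a prime and let $n$ be a positive integer. (1) If $q\equiv 3 \pmod 4$, then for every odd positive divisor $k$ of $n$ there exists a separable $\infty$-integral point $Q_k$ on the elliptic curve $E_{t^{q^n}-t}:\ (t^{q^n}-t)y^2=x^3-x$ over $\mathbb{F}_q(t)$. (2) If $q\equiv 2\pmod 3$, then for every odd positive divisor $k$ of $n$ there exists a separable $\infty$-integral point on the elliptic curve $y^2-y=(t^{q^n}-t)x^3$ over $\mathbb{F}_q(t)$.
   Context: A point $(F(t),G(t))$ of an elliptic curve over $\mathbb{F}_q(t)$ given by a Weierstrass-type equation is called $\infty$-integral if $F,G\in\mathbb{F}_q[t]$. An elliptic curve $E/\mathbb{F}_q(t)$ is isotrivial if there is an elliptic curve $E_1/\mathbb{F}_q$ and an isomorphism $\phi:E\to E_1$ defined over some finite extension of $\mathbb{F}_q(t)$. The Frobenius endomorphism of $E$ is $\mathbf{F}=\phi^{-1}\circ \mathrm{Fr}\circ\phi$, where $\mathrm{Fr}(x,y)=(x^q,y^q)$ on $E_1$; the Frobenius orbit of a point $P$ is $\{\mathbf{F}^i(P): i\in\mathbb{N}\}$. A non-constant point $P$ of an isotrivial elliptic curve is separable if it is not contained in the Frobenius orbit of any other point of $E$. (For a quadratic twist $d(t)y^2=f(x)$ with $d,f$ polynomials, a point $(x_0,y_0)$ is separable iff $x_0'\neq 0$, where $'$ is the formal derivative in $t$.) *)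

theory Defs
  imports
    "HOL-Algebra.Algebraic_Closure_Type"
    "HOL-Computational_Algebra.Computational_Algebra"
    "HOL-Library.Cardinality"
    "HOL-Number_Theory.Prime_Powers"
begin

text \<open>
  For a finite field \<open>'q\<close>, the polynomial ring, the rational function field and its algebraic
  closure are \<open>'q poly\<close>, \<open>'q poly fract\<close> and \<open>'q poly fract alg_closure\<close>.
\<close>

type_synonym 'q ratfun = "'q poly fract"
type_synonym 'q ratfun_closure = "'q ratfun alg_closure"

definition const_ratfun :: "'q::field \<Rightarrow> 'q ratfun" where
  "const_ratfun c = to_fract [:c:]"

subsection \<open>Plane cubics of Weierstrass type\<close>

text \<open>
  \<open>Curve b a1 a3 c a2 a4 a6\<close> stands for
  \<open>b y^2 + a1 x y + a3 y = c x^3 + a2 x^2 + a4 x + a6\<close>. Allowing \<open>b\<close> and \<open>c\<close> other than 1 covers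
  twists such as \<open>d y^2 = x^3 - x\<close> and \<open>y^2 - y = d x^3\<close>.
\<close>

datatype 'f curve = Curve 'f 'f 'f 'f 'f 'f 'f

datatype 'f point = Infty | Aff 'f 'f

fun weq :: "'f::field curve \<Rightarrow> 'f \<Rightarrow> 'f \<Rightarrow> 'f" where
  "weq (Curve b a1 a3 c a2 a4 a6) x y =
     b * y^2 + a1 * x * y + a3 * y - (c * x^3 + a2 * x^2 + a4 * x + a6)"

fun weq_dx :: "'f::field curve \<Rightarrow> 'f \<Rightarrow> 'f \<Rightarrow> 'f" where
  "weq_dx (Curve b a1 a3 c a2 a4 a6) x y = a1 * y - (3 * c * x^2 + 2 * a2 * x + a4)"

fun weq_dy :: "'f::field curve \<Rightarrow> 'f \<Rightarrow> 'f \<Rightarrow> 'f" where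
  "weq_dy (Curve b a1 a3 c a2 a4 a6) x y = 2 * b * y + a1 * x + a3"

definition points :: "'f::field curve \<Rightarrow> 'f point set" where
  "points E = insert Infty {Aff x y | x y. weq E x y = 0}"

fun proper_cubic :: "'f::field curve \<Rightarrow> bool" where
  "proper_cubic (Curve b a1 a3 c a2 a4 a6) \<longleftrightarrow> b \<noteq> 0 \<and> c \<noteq> 0"

text \<open>
  Smoothness is required at all geometric points; the point at infinity is automatically a smooth
  flex when \<open>b\<close> and \<open>c\<close> are non-zero, and it is the origin of the group law.
\<close>

definition elliptic :: "'f::field curve \<Rightarrow> bool" where
  "elliptic E \<longleftrightarrow> proper_cubic E \<and>
     (let E' = map_curve to_ac E in
       \<not> (\<exists>x y. weq E' x y = 0 \<and> weq_dx E' x y = 0 \<and> weq_dy E' x y = 0))"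

subsection \<open>Isomorphisms and the Frobenius endomorphism\<close>

text \<open>
  Isomorphisms of elliptic curves given by Weierstrass equations are exactly the affine changes of
  variables below that carry one equation to a non-zero multiple of the other. The function is a
  bijection of the whole affine plane together with \<open>Infty\<close>. Over an infinite field the pointwise identity is an identity of polynomials.
\<close>

fun affine_change :: "'f::field \<Rightarrow> 'f \<Rightarrow> 'f \<Rightarrow> 'f \<Rightarrow> 'f \<Rightarrow> 'f point \<Rightarrow> 'f point" where
  "affine_change u r v s w Infty = Infty"
| "affine_change u r v s w (Aff x y) = Aff (u * x + r) (v * y + s * x + w)"

definition curve_iso :: "'f::field curve \<Rightarrow> 'f curve \<Rightarrow> ('f point \<Rightarrow> 'f point) \<Rightarrow> bool" where
  "curve_iso E E1 \<phi> \<longleftrightarrow>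
     (\<exists>u r v s w e. u \<noteq> 0 \<and> v \<noteq> 0 \<and> e \<noteq> 0 \<and> \<phi> = affine_change u r v s w \<and>
        (\<forall>x y. weq E1 (u * x + r) (v * y + s * x + w) = e * weq E x y))"

text \<open>
  \<open>trivializes E E1 \<phi>\<close>: \<open>\<phi>\<close> is an isomorphism from \<open>E\<close> to the constant curve \<open>E1\<close>. The finitely
  many coefficients of \<open>\<phi>\<close> are algebraic, so it is defined over a finite extension of the
  rational function field.
\<close>

definition trivializes ::
  "'q::field ratfun curve \<Rightarrow> 'q curve \<Rightarrow> ('q ratfun_closure point \<Rightarrow> 'q ratfun_closure point) \<Rightarrow> bool"
where
  "trivializes E E1 \<phi> \<longleftrightarrow> elliptic E1 \<and>
     curve_iso (map_curve to_ac E) (map_curve (\<lambda>c. to_ac (const_ratfun c)) E1) \<phi>"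

definition isotrivial :: "'q::field ratfun curve \<Rightarrow> bool" where
  "isotrivial E \<longleftrightarrow> elliptic E \<and> (\<exists>E1 \<phi>. trivializes E E1 \<phi>)"

definition Fr :: "'q::{field,finite} ratfun_closure point \<Rightarrow> 'q ratfun_closure point" where
  "Fr = map_point (\<lambda>x. x ^ CARD('q))"

definition frobenius ::
  "('q::{field,finite} ratfun_closure point \<Rightarrow> 'q ratfun_closure point) \<Rightarrow>
   'q ratfun_closure point \<Rightarrow> 'q ratfun_closure point"
where
  "frobenius \<phi> = inv_into UNIV \<phi> \<circ> Fr \<circ> \<phi>"

definition frobenius_orbit ::
  "('q::{field,finite} ratfun_closure point \<Rightarrow> 'q ratfun_closure point) \<Rightarrow>
   'q ratfun_closure point \<Rightarrow> 'q ratfun_closure point set"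
where
  "frobenius_orbit \<phi> P = {(frobenius \<phi> ^^ i) P | i. True}"

subsection \<open>Separable and integral points\<close>

definition constant_point :: "'q::field ratfun point \<Rightarrow> bool" where
  "constant_point P \<longleftrightarrow> P = Infty \<or> (\<exists>a b. P = Aff (const_ratfun a) (const_ratfun b))"

text \<open>
  The points \<open>P\<close> and \<open>Q\<close> are rational over the function field (over its algebraic closure every
  point is a Frobenius image), whereas the orbit of \<open>Q\<close> may leave it: \<open>\<phi>\<close>, and even
  \<open>frobenius \<phi>\<close>, need not be defined over the function field. The Frobenius endomorphism depends
  on the choice of \<open>\<phi>\<close> only up to an automorphism of the curve; the condition is imposed
  for every choice.
\<close>

definition separable_point :: "'q::{field,finite} ratfun curve \<Rightarrow> 'q ratfun point \<Rightarrow> bool" where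
  "separable_point E P \<longleftrightarrow> isotrivial E \<and> P \<in> points E \<and> \<not> constant_point P \<and>
     (\<forall>E1 \<phi>. trivializes E E1 \<phi> \<longrightarrow>
        (\<forall>Q \<in> points E. Q \<noteq> P \<longrightarrow>
           map_point to_ac P \<notin> frobenius_orbit \<phi> (map_point to_ac Q)))"

definition infty_integral :: "'q::field ratfun point \<Rightarrow> bool" where
  "infty_integral P \<longleftrightarrow> (\<exists>F G. P = Aff (to_fract F) (to_fract G))"

subsection \<open>The two families of curves\<close>

definition twist_factor :: "nat \<Rightarrow> nat \<Rightarrow> 'q::field ratfun" where
  "twist_factor q n = to_fract ([:0, 1:] ^ (q ^ n) - [:0, 1:])"

text \<open>\<open>(t^(q^n) - t) y^2 = x^3 - x\<close> and \<open>y^2 - y = (t^(q^n) - t) x^3\<close>:\<close>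

definition quadratic_twist_curve :: "nat \<Rightarrow> nat \<Rightarrow> 'q::field ratfun curve" where
  "quadratic_twist_curve q n = Curve (twist_factor q n) 0 0 1 0 (- 1) 0"

definition cubic_twist_curve :: "nat \<Rightarrow> nat \<Rightarrow> 'q::field ratfun curve" where
  "cubic_twist_curve q n = Curve 1 0 (- 1) (twist_factor q n) 0 0 0"

end

theory Submission
  imports Defs "HOL-Number_Theory.Residues"
begin

text \<open>
  Let \<open>Q = q^k\<close>, and let \<open>T\<close> be the sum of the \<open>t^(Q^i)\<close> with \<open>i < n / k\<close>, so that
  \<open>T^Q - T = t^(q^n) - t\<close> and \<open>T' = 1\<close>. The points are
  \<open>(T^((Q - 1) / 2), T^((Q - 3) / 4))\<close> and \<open>(T^((Q - 2) / 3), T^(Q - 1))\<close>; the exponents are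
  integers because \<open>k\<close> is odd.

  For separability, write the \<open>x\<close>-coordinate of a trivialisation as \<open>u x + r\<close>. A point in the
  orbit of \<open>(x0, y0)\<close> satisfies \<open>u x + r = (u x0 + r)^(q^i)\<close> with \<open>i > 0\<close>. On the quadratic twist,
  \<open>r\<close> and \<open>u + r\<close> are \<open>x\<close>-coordinates of 2-torsion points of a constant curve, hence \<open>u\<close> and \<open>r\<close>
  are algebraic over \<open>GF(q)\<close>; comparing with a power of Frobenius that fixes them shows that \<open>x\<close>
  is a \<open>q\<close>-th power, so \<open>x' = 0\<close>. On the cubic twist, \<open>r\<close> comes from a flex and is again algebraic,
  but only the cube of \<open>u\<close> is an algebraic multiple of \<open>d = t^(q^n) - t\<close>. As \<open>d\<close> is not a constant
  times a cube, \<open>d x^3 = y^2 - y\<close> is a \<open>q\<close>-th power, which contradicts \<open>(y^2 - y)' \<noteq> 0\<close>.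
\<close>

lemma power_pow_pred:
  fixes x :: "'a::monoid_mult" and q i :: nat
  assumes "i > 0"
  shows "x ^ (q ^ i) = (x ^ (q ^ (i - 1))) ^ q"
proof -
  have "q ^ i = q ^ (i - 1) * q" using assms by (cases i) simp_all
  then show ?thesis by (simp only: power_mult)
qed

lemma power_swap: "((x :: 'a::monoid_mult) ^ a) ^ b = (x ^ b) ^ a"
  by (simp only: power_mult[symmetric] mult.commute)

subsection \<open>Fields in which a power map is additive\<close>

text \<open>Additivity is assumed directly, with no reference to a characteristic, so that one
  development serves an algebraic closure and, by injectivity of \<open>to_ac\<close>, the field
  below it.\<close>

locale frobenius_field =
  fixes q :: nat and ty :: "'a::field itself"
  assumes q_gt_1: "q > 1"
    and power_add: "(x + y :: 'a) ^ q = x ^ q + y ^ q"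
begin

lemma add_pow: "(x + y :: 'a) ^ (q ^ m) = x ^ (q ^ m) + y ^ (q ^ m)"
  by (induction m) (simp_all add: power_mult power_add power_Suc2 del: power_Suc)

lemma q_pos [simp]: "q > 0"
  using q_gt_1 by simp

lemma diff_pow: "(x - y :: 'a) ^ (q ^ m) = x ^ (q ^ m) - y ^ (q ^ m)"
  using add_pow[of "x - y" y m] by (simp add: algebra_simps)

lemma sum_pow: "(\<Sum>i\<in>A. f i :: 'a) ^ (q ^ m) = (\<Sum>i\<in>A. f i ^ (q ^ m))"
  by (induction A rule: infinite_finite_induct) (simp_all add: add_pow power_0_left)

lemma pow_eq_iff: "(x :: 'a) ^ (q ^ m) = y ^ (q ^ m) \<longleftrightarrow> x = y"
proof
  assume "x ^ (q ^ m) = y ^ (q ^ m)"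
  then have "(x - y) ^ (q ^ m) = 0" by (simp add: diff_pow)
  then show "x = y" by simp
qed simp

text \<open>The elements fixed by some power of Frobenius, that is, those algebraic over \<open>GF(q)\<close>.\<close>

definition alg :: "'a \<Rightarrow> bool" where
  "alg z \<longleftrightarrow> (\<exists>m>0. z ^ (q ^ m) = z)"

lemma fixed_mult:
  assumes "(z :: 'a) ^ (q ^ m) = z"
  shows "z ^ (q ^ (m * j)) = z"
proof (induction j)
  case (Suc j)
  have "z ^ (q ^ (m * Suc j)) = (z ^ (q ^ (m * j))) ^ (q ^ m)"
    by (simp add: Power.power_add mult.commute flip: power_mult)
  then show ?case using Suc assms by simp
qed simp

lemma alg_common:
  assumes "finite S" "\<forall>z\<in>S. alg z"
  obtains M where "M > 0" "\<forall>z\<in>S. z ^ (q ^ M) = z"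
proof -
  have "\<exists>M>0. \<forall>z\<in>S. z ^ (q ^ M) = z"
    using assms
  proof (induction S rule: finite_induct)
    case (insert a S)
    then obtain M m where "M > 0" "\<forall>z\<in>S. z ^ (q ^ M) = z" "m > 0" "a ^ (q ^ m) = a"
      by (auto simp: alg_def)
    \<comment> \<open>The product of two periods is a common period.\<close>
    then have "M * m > 0" "\<forall>z\<in>insert a S. z ^ (q ^ (M * m)) = z"
      using fixed_mult by (simp_all, metis mult.commute)
    then show ?case by blast
  qed auto
  then show ?thesis using that by blast
qed

lemma alg_0 [simp]: "alg 0" and alg_1 [simp]: "alg 1"
  by (auto simp: alg_def power_0_left intro: exI[of _ 1])

lemma alg_pair:
  assumes "alg x" "alg y"
  obtains M where "M > 0" "x ^ (q ^ M) = x" "y ^ (q ^ M) = y"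
  using alg_common[of "{x, y}"] assms by auto

lemma alg_add: "alg x \<Longrightarrow> alg y \<Longrightarrow> alg (x + y)"
  by (metis alg_pair alg_def add_pow)

lemma alg_diff: "alg x \<Longrightarrow> alg y \<Longrightarrow> alg (x - y)"
  by (metis alg_pair alg_def diff_pow)

lemma alg_minus: "alg x \<Longrightarrow> alg (- x)"
  using alg_diff[of 0 x] by simp

lemma alg_mult: "alg x \<Longrightarrow> alg y \<Longrightarrow> alg (x * y)"
  by (metis alg_pair alg_def power_mult_distrib)

lemma alg_divide: "alg x \<Longrightarrow> alg y \<Longrightarrow> alg (x / y)"
  by (metis alg_pair alg_def power_divide)

lemma alg_power: "alg x \<Longrightarrow> alg (x ^ n)"
  by (induction n) (simp_all add: alg_mult)

lemma alg_of_nat: "alg (of_nat n)"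
  by (induction n) (simp_all add: alg_add)

lemma alg_numeral: "alg (numeral n)"
  using alg_of_nat[of "numeral n"] by simp

lemmas alg_closed = alg_add alg_diff alg_minus alg_mult alg_divide alg_power alg_numeral

lemma alg_fixed: "z ^ q = z \<Longrightarrow> alg z"
  unfolding alg_def by (rule exI[of _ 1]) simp

text \<open>A power of Frobenius fixes the coefficients, hence permutes the finitely many roots.\<close>

lemma alg_root:
  fixes p :: "'a poly"
  assumes "p \<noteq> 0" "\<And>i. alg (coeff p i)" "poly p z = 0"
  shows "alg z"
proof -
  obtain M where M: "M > 0" "\<forall>c\<in>coeff p ` {..degree p}. c ^ (q ^ M) = c"
    using alg_common[of "coeff p ` {..degree p}"] assms(2) by auto
  have step: "poly p (y ^ (q ^ M)) = poly p y ^ (q ^ M)" for y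
  proof -
    have "poly p y ^ (q ^ M) = (\<Sum>i\<le>degree p. (coeff p i * y ^ i) ^ (q ^ M))"
      unfolding poly_altdef by (rule sum_pow)
    also have "\<dots> = (\<Sum>i\<le>degree p. coeff p i * (y ^ (q ^ M)) ^ i)"
      using M(2) by (intro sum.cong) (simp_all add: power_mult_distrib mult.commute flip: power_mult)
    finally show ?thesis by (simp add: poly_altdef)
  qed
  have "poly p (z ^ (q ^ (M * j))) = 0" for j
  proof (induction j)
    case (Suc j)
    have "z ^ (q ^ (M * Suc j)) = (z ^ (q ^ (M * j))) ^ (q ^ M)"
      by (simp add: Power.power_add mult.commute flip: power_mult)
    then show ?case using Suc step by (simp add: power_0_left)
  qed (use assms in simp)
  then have "range (\<lambda>j. z ^ (q ^ (M * j))) \<subseteq> {y. poly p y = 0}" by auto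
  then have "finite (range (\<lambda>j. z ^ (q ^ (M * j))))"
    using poly_roots_finite[OF assms(1)] finite_subset by blast
  then obtain i j where "z ^ (q ^ (M * i)) = z ^ (q ^ (M * j))" "i < j"
    using finite_imageD[of "\<lambda>j. z ^ (q ^ (M * j))" UNIV] infinite_UNIV_nat
    by (metis (no_types, lifting) inj_def linorder_neqE_nat)
  \<comment> \<open>Frobenius powers are injective, so the first \<open>i\<close> steps of the orbit
    cancel and \<open>z\<close> itself is periodic.\<close>
  then have "z ^ (q ^ (M * i)) = (z ^ (q ^ (M * (j - i)))) ^ (q ^ (M * i))"
    by (simp add: diff_mult_distrib2 flip: power_mult Power.power_add)
  then have "z ^ (q ^ (M * (j - i))) = z" by (metis pow_eq_iff)
  then show ?thesis using M(1) \<open>i < j\<close>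
    unfolding alg_def by (intro exI[of _ "M * (j - i)"]) simp
qed

end

subsection \<open>Descent from the algebraic closure\<close>

locale frobenius_closure = frobenius_field q ty for q and ty :: "'k::field alg_closure itself"
begin

sublocale base: frobenius_field q "TYPE('k)"
proof
  fix x y :: 'k
  have "to_ac ((x + y) ^ q) = to_ac (x ^ q + y ^ q)" by (simp add: power_add)
  then show "(x + y) ^ q = x ^ q + y ^ q" by (simp only: to_ac_eq_iff)
qed (rule q_gt_1)

lemma fixed_imp_qth_power:
  assumes "(x :: 'k) ^ (q ^ M) = x" "M > 0"
  shows "\<exists>w. x = w ^ q"
proof -
  have "x = (x ^ (q ^ (M - 1))) ^ q"
    using assms power_pow_pred by metis
  then show ?thesis by blast
qed

text \<open>Subtracting the equation from its \<open>q^M\<close>-th power eliminates \<open>\<beta>\<close> and shows that \<open>\<alpha>\<close> is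
  rational over the base field.\<close>

lemma qth_power_descent:
  fixes x z :: 'k
  assumes "alg \<alpha>" "alg \<beta>" and eq: "to_ac x = \<alpha> * to_ac (z ^ q) + \<beta>"
  shows "\<exists>w. x = w ^ q"
proof -
  obtain M where M: "M > 0" "\<alpha> ^ (q ^ M) = \<alpha>" "\<beta> ^ (q ^ M) = \<beta>"
    using alg_pair assms by blast
  define N where "N = q ^ M"
  have qM: "y ^ N = (y ^ (q ^ (M - 1))) ^ q" for y :: 'k
    unfolding N_def using M(1) by (rule power_pow_pred)
  have "to_ac x ^ N = \<alpha> * to_ac (z ^ q) ^ N + \<beta>"
    unfolding eq N_def add_pow power_mult_distrib M(2,3) ..
  then have diff: "to_ac (x ^ N - x) = \<alpha> * to_ac ((z ^ q) ^ N - z ^ q)"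
    using eq by (simp add: algebra_simps)
  show ?thesis
  proof (cases "(z ^ q) ^ N = z ^ q")
    case True
    then have "to_ac (x ^ N - x) = 0" using diff by simp
    then show ?thesis using fixed_imp_qth_power[of x M] M by (simp add: N_def del: to_ac_diff)
  next
    case False
    define a where "a = (x ^ N - x) / ((z ^ q) ^ N - z ^ q)"
    have a: "\<alpha> = to_ac a"
      using diff False unfolding a_def to_ac_divide
      by (metis nonzero_mult_div_cancel_right right_minus_eq to_ac_eq_0_iff)
    then have aN: "a ^ N = a" using M(2) unfolding N_def by (metis to_ac_eq_iff to_ac_power)
    \<comment> \<open>Every term becomes a \<open>q\<close>-th power: \<open>a\<close> equals
      \<open>a ^ N\<close>, and an \<open>N\<close>-th power is a \<open>q\<close>-th power because
      \<open>M > 0\<close>.\<close>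
    have "x = x ^ N - a * ((z ^ q) ^ N - z ^ q)"
      using False by (simp add: a_def)
    also have "\<dots> = x ^ N - a ^ N * ((z ^ N) ^ q - z ^ q)"
      by (simp only: aN power_swap[of z N q])
    also have "\<dots> = (x ^ (q ^ (M - 1))) ^ q - (a ^ (q ^ (M - 1))) ^ q * ((z ^ N) ^ q - z ^ q)"
      by (simp only: qM[of x] qM[of a])
    also have "\<dots> = (x ^ (q ^ (M - 1)) - a ^ (q ^ (M - 1)) * (z ^ N - z)) ^ q"
      by (simp only: power_mult_distrib base.diff_pow[of _ _ 1, unfolded power_one_right])
    finally show ?thesis by blast
  qed
qed

text \<open>If \<open>k = r^Q - r\<close> is non-zero, the equation and its \<open>N\<close>-th power are linear in \<open>u\<close> and
  \<open>u^Q\<close> over the base field, because \<open>u^N\<close> is a rational multiple of \<open>u\<close>. A non-zero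
  determinant makes \<open>u\<close> a rational multiple of \<open>k\<close>, so that \<open>d\<close> is a constant times a cube; a
  zero determinant makes \<open>d x^3\<close> constant.\<close>

lemma cube_twist_descent:
  fixes d x x0 :: 'k and u r \<epsilon> :: "'k alg_closure"
  assumes "alg r" "alg \<epsilon>" and cube: "u ^ 3 = \<epsilon> * to_ac d"
    and eq: "u * to_ac x + r = (u * to_ac x0 + r) ^ (q ^ i)"
    and i: "i > 0" and u: "u \<noteq> 0" and x: "x \<noteq> 0" and q: "\<not> 3 dvd q"
    and not_cube: "\<And>g M. g \<noteq> 0 \<Longrightarrow> M > 0 \<Longrightarrow> (d * g ^ 3) ^ (q ^ M) \<noteq> d * g ^ 3"
  shows "\<exists>w. d * x ^ 3 = w ^ q"
proof -
  define Q where "Q = q ^ i"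
  define k where "k = r ^ Q - r"
  define z where "z = x0 ^ Q"
  have [simp]: "\<epsilon> \<noteq> 0" "d \<noteq> 0" using cube u by auto
  have eq1: "to_ac x * u - to_ac z * u ^ Q = k"
    using eq by (simp add: k_def z_def Q_def add_pow power_mult_distrib algebra_simps)
  have "alg k" unfolding k_def using assms by (intro alg_closed)
  show ?thesis
  proof (cases "k = 0")
    case True
    \<comment> \<open>Cubing replaces \<open>u\<close> by an algebraic multiple of \<open>d\<close>,
      leaving the shape required by \<open>qth_power_descent\<close>.\<close>
    have "\<epsilon> * to_ac (d * x ^ 3) = (u * to_ac x) ^ 3"
      by (simp add: power_mult_distrib cube)
    also have "\<dots> = (u ^ Q * to_ac z) ^ 3" using True eq1 by (simp add: mult.commute)
    also have "\<dots> = (u ^ 3) ^ Q * to_ac (x0 ^ 3) ^ Q"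
      by (simp only: z_def power_mult_distrib to_ac_power power_swap[of _ Q 3])
    also have "\<dots> = \<epsilon> ^ Q * to_ac ((d * x0 ^ 3) ^ Q)"
      by (simp add: cube power_mult_distrib)
    finally have "to_ac (d * x ^ 3) = \<epsilon> ^ Q / \<epsilon> * to_ac ((d * x0 ^ 3) ^ Q)"
      by (simp add: field_simps)
    moreover have "(d * x0 ^ 3) ^ Q = ((d * x0 ^ 3) ^ (q ^ (i - 1))) ^ q"
      unfolding Q_def using i by (rule power_pow_pred)
    ultimately have "to_ac (d * x ^ 3) = \<epsilon> ^ Q / \<epsilon> * to_ac (((d * x0 ^ 3) ^ (q ^ (i - 1))) ^ q) + 0"
      by simp
    then show ?thesis
      by (rule qth_power_descent[OF _ alg_0, rotated]) (intro alg_divide alg_power assms(2))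
  next
    case False
    obtain \<kappa> where \<kappa>: "\<kappa> ^ 3 = \<epsilon>" using nth_root_exists[of 3 \<epsilon>] by auto
    have "alg \<kappa>"
    proof (rule alg_root)
      show "alg (coeff [:- \<epsilon>, 0, 0, 1:] j)" for j
        using assms(2) by (auto simp: coeff_pCons alg_minus split: nat.splits)
    qed (use \<kappa> in \<open>auto simp: power3_eq_cube\<close>)
    then obtain M0 where M0: "M0 > 0" "\<kappa> ^ (q ^ M0) = \<kappa>" "k ^ (q ^ M0) = k"
      using \<open>alg k\<close> alg_pair by blast
    \<comment> \<open>Doubling makes \<open>N\<close> a square prime to 3, hence 1 modulo 3. Then
      \<open>u ^ N\<close> is \<open>u\<close> times a power of \<open>u ^ 3\<close>, whose constant
      factor is 1.\<close>
    define M where "M = M0 * 2"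
    define N where "N = q ^ M"
    have M: "M > 0" "\<kappa> ^ N = \<kappa>" "k ^ N = k"
      using M0 fixed_mult by (auto simp: M_def N_def)
    have "N mod 3 = 1"
    proof -
      have "\<not> 3 dvd q ^ M0" using q prime_dvd_power[of 3 q M0] by auto
      then have "q ^ M0 mod 3 = 1 \<or> q ^ M0 mod 3 = 2" by arith
      moreover have "N = q ^ M0 * q ^ M0" by (simp add: N_def M_def power_mult power2_eq_square)
      ultimately show ?thesis by (auto simp: mod_mult_eq[of "q ^ M0" 3 "q ^ M0", symmetric])
    qed
    then obtain j where j: "N = 3 * j + 1" by (metis mod_div_mult_eq add.commute mult.commute)
    define D where "D = d ^ j"
    have "\<kappa> \<noteq> 0" using \<kappa> by auto
    then have \<kappa>1: "\<kappa> ^ (3 * j) = 1" using M(2) by (simp add: j)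
    have uN: "u ^ N = u * to_ac D"
    proof -
      have "u ^ N = u * (u ^ 3) ^ j" by (simp add: j power_mult)
      also have "\<dots> = u * (\<kappa> ^ (3 * j) * to_ac d ^ j)"
        by (simp add: cube power_mult_distrib power_mult \<kappa>)
      finally show ?thesis by (simp add: \<kappa>1 D_def)
    qed
    have "(to_ac x * u - to_ac z * u ^ Q) ^ N = k" using eq1 M by simp
    then have "(to_ac x * u) ^ N - (to_ac z * u ^ Q) ^ N = k"
      unfolding N_def by (simp add: diff_pow)
    moreover have "(u ^ Q) ^ N = (u ^ N) ^ Q" by (simp add: mult.commute flip: power_mult)
    ultimately have eq2: "to_ac (D * x ^ N) * u - to_ac (D ^ Q * z ^ N) * u ^ Q = k"
      by (simp add: power_mult_distrib uN algebra_simps)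
    \<comment> \<open>Up to sign, the determinant of the system \<open>eq1\<close>,
      \<open>eq2\<close> in \<open>u\<close> and \<open>u ^ Q\<close>. The formulas for its products
      with these unknowns are Cramer's rule.\<close>
    define \<Delta> where "\<Delta> = x * (D ^ Q * z ^ N) - z * (D * x ^ N)"
    have \<Delta>u: "to_ac \<Delta> * u = k * to_ac (D ^ Q * z ^ N - z)"
    proof -
      have "to_ac \<Delta> * u = (to_ac x * u - to_ac z * u ^ Q) * to_ac (D ^ Q * z ^ N)
          - (to_ac (D * x ^ N) * u - to_ac (D ^ Q * z ^ N) * u ^ Q) * to_ac z"
        by (simp add: \<Delta>_def algebra_simps)
      then show ?thesis unfolding eq1 eq2 by (simp add: algebra_simps)
    qed
    have "\<Delta> = 0"
    proof (rule ccontr)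
      assume "\<Delta> \<noteq> 0"
      define g where "g = (D ^ Q * z ^ N - z) / \<Delta>"
      have ug: "u = k * to_ac g"
        using \<Delta>u \<open>\<Delta> \<noteq> 0\<close> by (simp add: g_def field_simps)
      then have "g \<noteq> 0" using u by auto
      have "\<epsilon> * to_ac d = k ^ 3 * to_ac g ^ 3"
        unfolding cube[symmetric] ug by (simp add: power_mult_distrib)
      then have c: "to_ac (d * (1 / g) ^ 3) = k ^ 3 / \<epsilon>"
        using \<open>g \<noteq> 0\<close> by (simp add: field_simps)
      have "(k ^ 3 / \<epsilon>) ^ N = (k ^ N) ^ 3 / (\<kappa> ^ N) ^ 3"
        by (simp add: power_divide mult.commute flip: power_mult \<kappa>)
      then have "to_ac (d * (1 / g) ^ 3) ^ N = to_ac (d * (1 / g) ^ 3)"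
        unfolding c by (simp add: M \<kappa>)
      then have "(d * (1 / g) ^ 3) ^ N = d * (1 / g) ^ 3"
        by (metis to_ac_eq_iff to_ac_power)
      then show False using not_cube[of "1 / g" M] \<open>g \<noteq> 0\<close> M by (simp add: N_def)
    qed
    have "k * to_ac (D * x ^ N - x) = to_ac \<Delta> * u ^ Q"
    proof -
      have "to_ac \<Delta> * u ^ Q = (to_ac x * u - to_ac z * u ^ Q) * to_ac (D * x ^ N)
          - (to_ac (D * x ^ N) * u - to_ac (D ^ Q * z ^ N) * u ^ Q) * to_ac x"
        by (simp add: \<Delta>_def algebra_simps)
      then show ?thesis unfolding eq1 eq2 by (simp add: algebra_simps)
    qed
    then have "k * to_ac (D * x ^ (3 * j) - 1) * to_ac x = 0"
      using \<open>\<Delta> = 0\<close> by (simp add: j algebra_simps)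
    then have Dx: "D * x ^ (3 * j) = 1" using False x
      by (metis mult_eq_0_iff right_minus_eq to_ac_eq_0_iff)
    \<comment> \<open>The cube of \<open>D * x ^ (3 * j)\<close> is the \<open>(N - 1)\<close>-th
      power of \<open>d * x ^ 3\<close>.\<close>
    have "(d * x ^ 3) ^ N = d * x ^ 3 * (D * x ^ (3 * j)) ^ 3"
      by (simp add: j D_def power_mult_distrib mult_ac flip: power_mult)
    then have "(d * x ^ 3) ^ (q ^ M) = d * x ^ 3" using Dx by (simp add: N_def)
    then show ?thesis using fixed_imp_qth_power M(1) by blast
  qed
qed

text \<open>Where the \<open>y\<close>-derivative vanishes, \<open>x\<close> is a root of the
  discriminant of the equation in \<open>y\<close>. This is a cubic with algebraic coefficients,
  non-zero because 2 is invertible.\<close>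

lemma two_torsion_alg:
  assumes "alg b" "alg a1" "alg a3" "alg c" "alg a2" "alg a4" "alg a6"
    and "b \<noteq> 0" "c \<noteq> 0" "(2 :: 'k) \<noteq> 0"
    and "weq (Curve b a1 a3 c a2 a4 a6) x y = 0" "weq_dy (Curve b a1 a3 c a2 a4 a6) x y = 0"
  shows "alg x"
proof (rule alg_root)
  let ?p = "[:- (a3\<^sup>2 + 4 * b * a6), - (2 * a1 * a3 + 4 * b * a4), - (a1\<^sup>2 + 4 * b * a2), - (4 * b * c):]"
  show "alg (coeff ?p i)" for i
    by (auto simp: coeff_pCons split: nat.splits intro!: alg_closed assms alg_0)
  have two: "(2 :: 'k alg_closure) \<noteq> 0" using assms(10) by (metis to_ac_eq_0_iff to_ac_numeral)
  then have "(4 :: 'k alg_closure) \<noteq> 0" using mult_eq_0_iff[of 2 "2 :: 'k alg_closure"] by simp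
  then show "?p \<noteq> 0" using assms by simp
  \<comment> \<open>Completing the square eliminates \<open>y\<close>.\<close>
  have "poly ?p x = 4 * b * weq (Curve b a1 a3 c a2 a4 a6) x y - (weq_dy (Curve b a1 a3 c a2 a4 a6) x y)\<^sup>2"
    by (simp add: algebra_simps power2_eq_square power3_eq_cube)
  then show "poly ?p x = 0" using assms by simp
qed

text \<open>The equations \<open>l0\<close>, \<open>l1\<close>, \<open>l2\<close> say that the line of slope \<open>\<mu>\<close> through \<open>(r, w)\<close> meets the
  cubic there with multiplicity three. Eliminating \<open>r\<close> leaves a quartic for \<open>\<mu>\<close>.\<close>

lemma flex_alg:
  assumes "alg b" "alg a1" "alg a3" "alg c" "alg a2" "alg a4" "alg a6"
    and "b \<noteq> 0" "c \<noteq> 0" "(3 :: 'k) \<noteq> 0"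
    and l0: "weq (Curve b a1 a3 c a2 a4 a6) r w = 0"
    and l1: "2 * b * \<mu> * w + a1 * (r * \<mu> + w) + a3 * \<mu> - 3 * c * r\<^sup>2 - 2 * a2 * r - a4 = 0"
    and l2: "b * \<mu>\<^sup>2 + a1 * \<mu> - 3 * c * r - a2 = 0"
    and slope: "2 * b * \<mu> + a1 = 0"
  shows "alg r \<and> alg w"
proof -
  have three: "(3 :: 'k alg_closure) \<noteq> 0" using assms(10) by (metis to_ac_eq_0_iff to_ac_numeral)
  have "alg \<mu>"
  proof (rule alg_root)
    let ?p = "[:a2\<^sup>2 - 3 * c * a4, 3 * c * a3 - a1 * a2, 0, - (a1 * b), - b\<^sup>2:]"
    show "alg (coeff ?p i)" for i
      by (auto simp: coeff_pCons split: nat.splits intro!: alg_closed assms alg_0)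
    show "?p \<noteq> 0" using assms by simp
    define R where "R = 3 * c * r"
    have R: "R = b * \<mu>\<^sup>2 + a1 * \<mu> - a2" using l2 by (simp add: R_def algebra_simps)
    \<comment> \<open>The slope condition annihilates the coefficient of \<open>w\<close>; scaling
      by \<open>3 * c\<close> then leaves an equation in \<open>R\<close> and \<open>\<mu>\<close>
      only.\<close>
    have "w * (2 * b * \<mu> + a1) + (a1 * r * \<mu> + a3 * \<mu> - 3 * c * r\<^sup>2 - 2 * a2 * r - a4) = 0"
      using l1 by (simp add: algebra_simps)
    then have "3 * c * (a1 * r * \<mu> + a3 * \<mu> - 3 * c * r\<^sup>2 - 2 * a2 * r - a4) = 0"
      unfolding slope by simp
    then have "a1 * R * \<mu> + 3 * c * a3 * \<mu> - R\<^sup>2 - 2 * a2 * R - 3 * c * a4 = 0"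
      unfolding R_def by (simp add: algebra_simps power2_eq_square)
    then show "poly ?p \<mu> = 0"
      unfolding R by (simp add: algebra_simps power2_eq_square)
  qed
  have "r = (b * \<mu>\<^sup>2 + a1 * \<mu> - a2) / (3 * c)"
    using l2 three assms(9) by (simp add: field_simps)
  then have r: "alg r" using \<open>alg \<mu>\<close> assms by (auto intro!: alg_closed)
  have "alg w"
  proof (rule alg_root)
    let ?p = "[:- (c * r ^ 3 + a2 * r\<^sup>2 + a4 * r + a6), a1 * r + a3, b:]"
    show "alg (coeff ?p i)" for i
      by (auto simp: coeff_pCons split: nat.splits intro!: alg_closed assms r alg_0)
    show "?p \<noteq> 0" using assms by simp
    show "poly ?p w = 0" using l0 by (simp add: algebra_simps power2_eq_square)
  qed
  with r show ?thesis ..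
qed

end

subsection \<open>Affine changes of variables\<close>

lemma poly_eq_0_if_infinite:
  fixes p :: "'a::idom poly"
  assumes "infinite (UNIV :: 'a set)" "\<And>x. poly p x = 0"
  shows "p = 0"
  using poly_roots_finite[of p] assms by auto

text \<open>For fixed \<open>y\<close> this is a polynomial in \<open>x\<close> with infinitely many
  roots; its coefficients in turn are polynomials in \<open>y\<close> that vanish
  everywhere.\<close>

lemma bivariate_cubic_coeffs_0:
  fixes A B C D E F G :: "'a::field"
  assumes inf: "infinite (UNIV :: 'a set)"
    and "\<And>x y. A * y\<^sup>2 + B * x * y + C * y + D * x ^ 3 + E * x\<^sup>2 + F * x + G = 0"
  shows "A = 0 \<and> B = 0 \<and> C = 0 \<and> D = 0 \<and> E = 0 \<and> F = 0 \<and> G = 0"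
proof -
  have *: "[:A * y\<^sup>2 + C * y + G, B * y + F, E, D:] = 0" for y
  proof (rule poly_eq_0_if_infinite[OF inf])
    fix x
    have "poly [:A * y\<^sup>2 + C * y + G, B * y + F, E, D:] x =
        A * y\<^sup>2 + B * x * y + C * y + D * x ^ 3 + E * x\<^sup>2 + F * x + G"
      by (simp add: algebra_simps power2_eq_square power3_eq_cube)
    then show "poly [:A * y\<^sup>2 + C * y + G, B * y + F, E, D:] x = 0"
      by (simp only: assms(2))
  qed
  have "[:F, B:] = 0"
    using * by (intro poly_eq_0_if_infinite[OF inf]) (simp add: algebra_simps)
  moreover have "[:G, C, A:] = 0"
    using * by (intro poly_eq_0_if_infinite[OF inf]) (simp add: algebra_simps power2_eq_square)
  ultimately show ?thesis using *[of 0] by simp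
qed

text \<open>The relations compare the coefficients of y^2, xy, y, x^3, x^2, x and 1, in this
  order.\<close>

lemma weq_affine_change_coeffs:
  fixes b :: "'a::field"
  assumes "infinite (UNIV :: 'a set)"
    and "\<And>x y. weq (Curve b a1 a3 c a2 a4 a6) (u * x + r) (v * y + s * x + w) =
           e * weq (Curve b' a1' a3' c' a2' a4' a6') x y"
  shows "b * v\<^sup>2 = e * b'"
    and "2 * b * v * s + a1 * u * v = e * a1'"
    and "2 * b * v * w + a1 * r * v + a3 * v = e * a3'"
    and "c * u ^ 3 = e * c'"
    and "b * s\<^sup>2 + a1 * u * s - 3 * c * u\<^sup>2 * r - a2 * u\<^sup>2 = - e * a2'"
    and "2 * b * s * w + a1 * (r * s + u * w) + a3 * s - 3 * c * u * r\<^sup>2 - 2 * a2 * u * r - a4 * u = - e * a4'"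
    and "weq (Curve b a1 a3 c a2 a4 a6) r w = - e * a6'"
proof -
  let ?A = "b * v\<^sup>2 - e * b'" and ?B = "2 * b * v * s + a1 * u * v - e * a1'"
    and ?C = "2 * b * v * w + a1 * r * v + a3 * v - e * a3'"
    and ?D = "- (c * u ^ 3 - e * c')"
    and ?E = "b * s\<^sup>2 + a1 * u * s - 3 * c * u\<^sup>2 * r - a2 * u\<^sup>2 + e * a2'"
    and ?F = "2 * b * s * w + a1 * (r * s + u * w) + a3 * s - 3 * c * u * r\<^sup>2 - 2 * a2 * u * r - a4 * u + e * a4'"
    and ?G = "weq (Curve b a1 a3 c a2 a4 a6) r w + e * a6'"
  have "?A * y\<^sup>2 + ?B * x * y + ?C * y + ?D * x ^ 3 + ?E * x\<^sup>2 + ?F * x + ?G =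
      weq (Curve b a1 a3 c a2 a4 a6) (u * x + r) (v * y + s * x + w)
      - e * weq (Curve b' a1' a3' c' a2' a4' a6') x y" for x y
    by (simp add: algebra_simps power2_eq_square power3_eq_cube)
  then have "?A * y\<^sup>2 + ?B * x * y + ?C * y + ?D * x ^ 3 + ?E * x\<^sup>2 + ?F * x + ?G = 0" for x y
    by (simp only: assms(2) diff_self)
  from bivariate_cubic_coeffs_0[OF assms(1) this]
  have "?A = 0 \<and> ?B = 0 \<and> ?C = 0 \<and> ?D = 0 \<and> ?E = 0 \<and> ?F = 0 \<and> ?G = 0" .
  then show "b * v\<^sup>2 = e * b'"
    and "2 * b * v * s + a1 * u * v = e * a1'"
    and "2 * b * v * w + a1 * r * v + a3 * v = e * a3'"
    and "c * u ^ 3 = e * c'"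
    and "b * s\<^sup>2 + a1 * u * s - 3 * c * u\<^sup>2 * r - a2 * u\<^sup>2 = - e * a2'"
    and "2 * b * s * w + a1 * (r * s + u * w) + a3 * s - 3 * c * u * r\<^sup>2 - 2 * a2 * u * r - a4 * u = - e * a4'"
    and "weq (Curve b a1 a3 c a2 a4 a6) r w = - e * a6'"
    by (simp_all only: minus_mult_left[symmetric] eq_iff_diff_eq_0[symmetric] eq_neg_iff_add_eq_0 neg_equal_0_iff_equal)
qed

subsection \<open>Constants of the rational function field\<close>

lemma CHAR_fract [simp]: "CHAR('a::idom fract) = CHAR('a)"
proof (rule CHAR_eqI)
  have *: "of_nat n = to_fract (of_nat n :: 'a)" for n
    by (simp add: of_nat_fract to_fract_def)
  show "of_nat CHAR('a) = (0 :: 'a fract)" by (simp add: *)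
  show "CHAR('a) dvd n" if "of_nat n = (0 :: 'a fract)" for n
    using that by (simp add: * of_nat_eq_0_iff_char_dvd)
qed

lemma to_fract_power: "to_fract (x ^ n) = to_fract x ^ n"
  by (induction n) simp_all

lemma infinite_UNIV_ratfun_closure: "infinite (UNIV :: 'q::field ratfun_closure set)"
proof -
  have "inj (\<lambda>n. to_ac (to_fract (monom (1 :: 'q) n)))"
    by (rule injI) (simp add: monom_eq_iff')
  then have "infinite (range (\<lambda>n. to_ac (to_fract (monom (1 :: 'q) n))))"
    by (rule range_inj_infinite)
  then show ?thesis using finite_subset[OF subset_UNIV] by blast
qed

text \<open>Multiplication by a non-zero \<open>c\<close> permutes the non-zero elements; cancel
  their product.\<close>

lemma finite_field_power_card:
  "(c :: 'q::{field,finite}) ^ CARD('q) = c"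
proof (cases "c = 0")
  case False
  have "(\<Prod>y\<in>UNIV - {0}. c * y) = \<Prod>(UNIV - {0})"
    using False by (intro prod.reindex_bij_witness[of _ "\<lambda>y. y / c" "\<lambda>y. c * y"]) auto
  then have "c ^ card (UNIV - {0 :: 'q}) * \<Prod>(UNIV - {0 :: 'q}) = \<Prod>(UNIV - {0})"
    by (simp add: prod.distrib)
  then have "c ^ (CARD('q) - 1) = 1" by simp
  then have "c ^ Suc (CARD('q) - 1) = c" by (simp only: power_Suc mult_1_right)
  moreover have "Suc (CARD('q) - 1) = CARD('q)" by simp
  ultimately show ?thesis by (simp only:)
qed simp

lemma const_power_card:
  "to_ac (const_ratfun (c :: 'q::{field,finite})) ^ CARD('q) = to_ac (const_ratfun c)"
proof -
  have "[:c:] ^ n = [:c ^ n:]" for n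
    by (induction n) simp_all
  then have "const_ratfun c ^ CARD('q) = const_ratfun c"
    unfolding const_ratfun_def by (simp add: finite_field_power_card flip: to_fract_power)
  then show ?thesis by (metis to_ac_power)
qed

lemma primepow_card_CHAR:
  assumes "CARD('q::{field,finite}) = q" "primepow q"
  obtains l where "prime CHAR('q)" "l > 0" "q = CHAR('q) ^ l"
proof -
  have p: "prime CHAR('q)"
    by (intro prime_CHAR_semidom finite_imp_CHAR_pos) simp
  obtain p' l where l: "prime p'" "l > 0" "q = p' ^ l"
    using assms(2) unfolding primepow_def by blast
  have "CHAR('q) dvd p' ^ l"
    using CHAR_dvd_CARD[where 'a = 'q] assms(1) l(3) by simp
  then have "CHAR('q) = p'"
    using p l(1) prime_dvd_power primes_dvd_imp_eq by blast
  with p l show ?thesis by (intro that) simp_all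
qed

lemma frobenius_field_card:
  assumes "CARD('q::{field,finite}) = q" "primepow q" "CHAR('a::field) = CHAR('q)"
  shows "frobenius_field TYPE('a) q"
proof
  obtain l where l: "prime CHAR('q)" "l > 0" "q = CHAR('q) ^ l"
    using primepow_card_CHAR assms by blast
  then show "q > 1" using one_less_power[OF prime_gt_1_nat] by blast
  show "(x + y :: 'a) ^ q = x ^ q + y ^ q" for x y
    by (rule freshmans_dream'[of q l]) (use l assms(3) in simp_all)
qed

lemma frobenius_closure_card:
  assumes "CARD('q::{field,finite}) = q" "primepow q"
  shows "frobenius_closure TYPE('q ratfun) q"
  unfolding frobenius_closure_def by (rule frobenius_field_card[OF assms]) simp

lemma of_nat_card_eq_0:
  assumes "CARD('q::{field,finite}) = q"
  shows "of_nat q = (0 :: 'q)"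
  using CHAR_dvd_CARD[where 'a = 'q] assms of_nat_eq_0_iff_char_dvd by blast

lemma numeral_neq_0_if_coprime_card:
  assumes "CARD('q::{field,finite}) = q" "coprime (numeral m) q"
    and "CHAR('a::field) = CHAR('q)"
  shows "(numeral m :: 'a) \<noteq> 0"
proof
  assume "(numeral m :: 'a) = 0"
  then have "of_nat (numeral m) = (0 :: 'a)" by simp
  then have "CHAR('q) dvd numeral m" by (simp only: of_nat_eq_0_iff_char_dvd assms(3))
  moreover have "CHAR('q) dvd q" using CHAR_dvd_CARD[where 'a = 'q] assms(1) by simp
  ultimately have "CHAR('q) dvd 1" using assms(2) coprime_common_divisor by blast
  then have "of_nat 1 = (0 :: 'q)" by (simp only: of_nat_eq_0_iff_char_dvd)
  then show False by simp
qed

section \<open>Obstructions to being a \<open>q\<close>-th power or a constant times a cube\<close>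

lemma pderiv_power_card:
  fixes p :: "'q::{field,finite} poly"
  assumes "CARD('q) = q" "q dvd m"
  shows "pderiv (p ^ m) = 0"
proof -
  have "of_nat m = (0 :: 'q)" using assms of_nat_card_eq_0[OF assms(1)] by (auto simp: dvd_def)
  then show ?thesis by (simp add: pderiv_power)
qed

text \<open>Clearing the denominator gives \<open>F * b ^ q = a ^ q\<close>, and the derivative of a
  \<open>q\<close>-th power is zero.\<close>

lemma pderiv_eq_0_if_qth_power:
  fixes F :: "'q::{field,finite} poly"
  assumes "CARD('q) = q" "to_fract F = w ^ q"
  shows "pderiv F = 0"
proof -
  obtain a b where w: "w = Fract a b" "b \<noteq> 0" by (cases w) auto
  have "to_fract (F * b ^ q) = to_fract (a ^ q)"
    using assms(2) w by (simp add: Fract_conv_to_fract power_divide to_fract_power)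
  then have "F * b ^ q = a ^ q" by (simp only: to_fract_eq_iff)
  then have "pderiv (F * b ^ q) = 0" using pderiv_power_card[OF assms(1)] by simp
  then have "pderiv F * b ^ q = 0"
    by (auto simp: pderiv_mult pderiv_power_card[OF assms(1)])
  then show ?thesis using w(2) by simp
qed

text \<open>A non-zero element fixed by the \<open>N\<close>-th power is a root of unity, so it has
  degree 0; the degree of \<open>D * g ^ 3\<close> is that of \<open>D\<close> modulo 3.\<close>

lemma not_constant_times_cube:
  fixes D :: "'q::field poly" and g :: "'q ratfun"
  assumes "g \<noteq> 0" "N > 1" "D \<noteq> 0" "\<not> 3 dvd degree D"
  shows "(to_fract D * g ^ 3) ^ N \<noteq> to_fract D * g ^ 3"
proof
  assume eq: "(to_fract D * g ^ 3) ^ N = to_fract D * g ^ 3"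
  obtain a b where g: "g = Fract a b" "b \<noteq> 0" by (cases g) auto
  then have "a \<noteq> 0" using assms(1) by (auto simp: Fract_conv_to_fract)
  define M where "M = N - 1"
  have M: "N = Suc M" "M > 0" using assms(2) by (simp_all add: M_def)
  have "(to_fract D * g ^ 3) ^ M = 1"
    using eq assms by (simp add: M(1))
  then have "to_fract ((D * a ^ 3) ^ M) = to_fract ((b ^ 3) ^ M)"
    using g by (simp add: Fract_conv_to_fract to_fract_power power_mult_distrib power_divide field_simps)
  then have "(D * a ^ 3) ^ M = (b ^ 3) ^ M" by (simp only: to_fract_eq_iff)
  then have "degree ((D * a ^ 3) ^ M) = degree ((b ^ 3) ^ M)" by simp
  then have "M * (degree D + 3 * degree a) = M * (3 * degree b)"
    using assms(3) \<open>a \<noteq> 0\<close> g(2) by (simp add: degree_power_eq degree_mult_eq)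
  then have "degree D + 3 * degree a = 3 * degree b" using M(2) by simp
  then show False using assms(4) by presburger
qed

subsection \<open>Frobenius orbits\<close>

lemma Fr_funpow:
  "(Fr ^^ i) (Aff x y :: 'q::{field,finite} ratfun_closure point)
    = Aff (x ^ (CARD('q) ^ i)) (y ^ (CARD('q) ^ i))"
  "(Fr ^^ i) (Infty :: 'q ratfun_closure point) = Infty"
  by (induction i) (simp_all add: Fr_def power_mult mult.commute flip: power_mult)

lemma surj_affine_change:
  assumes "u \<noteq> 0" "v \<noteq> 0"
  shows "surj (affine_change u r v s w)"
proof (rule surjI)
  fix P
  show "affine_change u r v s w (case P of Infty \<Rightarrow> Infty
      | Aff x y \<Rightarrow> Aff ((x - r) / u) ((y - s * ((x - r) / u) - w) / v)) = P"
    using assms by (cases P) simp_all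
qed

lemma surj_frobenius_funpow:
  assumes "surj \<phi>"
  shows "\<phi> ((frobenius \<phi> ^^ i) P) = (Fr ^^ i) (\<phi> P)"
  by (induction i) (simp_all add: frobenius_def surj_f_inv_f[OF assms])

text \<open>Reduces separability to a statement about \<open>x\<close>-coordinates. The constant
  curve enters only through coefficients fixed by the \<open>q\<close>-th power, and
  \<open>i = 0\<close> is excluded because it would force \<open>Q\<close> to be the given
  point.\<close>

lemma separable_pointI:
  fixes E :: "'q::{field,finite} ratfun curve"
  assumes "isotrivial E" "Aff x y \<in> points E" "\<not> constant_point (Aff x y)"
    and descent: "\<And>b a1 a3 c a2 a4 a6 u r v s w e x0 i.
      \<lbrakk>b \<noteq> 0; c \<noteq> 0; \<forall>z\<in>{b, a1, a3, c, a2, a4, a6}. z ^ CARD('q) = z;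
       u \<noteq> 0; v \<noteq> 0; e \<noteq> 0;
       \<And>x y. weq (Curve b a1 a3 c a2 a4 a6) (u * x + r) (v * y + s * x + w)
          = e * weq (map_curve to_ac E) x y;
       i > 0; u * to_ac x + r = (u * to_ac x0 + r) ^ (CARD('q) ^ i)\<rbrakk> \<Longrightarrow> False"
  shows "separable_point E (Aff x y)"
  unfolding separable_point_def
proof (intro conjI allI impI ballI notI)
  fix E1 \<phi> Q
  assume triv: "trivializes E E1 \<phi>" and Q: "Q \<in> points E" "Q \<noteq> Aff x y"
    and orbit: "map_point to_ac (Aff x y) \<in> frobenius_orbit \<phi> (map_point to_ac Q)"
  obtain b a1 a3 c a2 a4 a6 where E1: "E1 = Curve b a1 a3 c a2 a4 a6" by (cases E1)
  from triv obtain u r v s w e where nz: "u \<noteq> 0" "v \<noteq> 0" "e \<noteq> 0"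
    and \<phi>: "\<phi> = affine_change u r v s w"
    and weq: "\<And>x y. weq (map_curve (\<lambda>c. to_ac (const_ratfun c)) E1) (u * x + r) (v * y + s * x + w)
          = e * weq (map_curve to_ac E) x y"
    unfolding trivializes_def curve_iso_def by blast
  from triv have bc: "b \<noteq> 0" "c \<noteq> 0"
    by (auto simp: trivializes_def elliptic_def E1)
  from orbit obtain i where i: "map_point to_ac (Aff x y) = (frobenius \<phi> ^^ i) (map_point to_ac Q)"
    unfolding frobenius_orbit_def by blast
  then have "\<phi> (map_point to_ac (Aff x y)) = (Fr ^^ i) (\<phi> (map_point to_ac Q))"
    using surj_frobenius_funpow surj_affine_change nz \<phi> by metis
  then obtain x0 y0 where Q0: "Q = Aff x0 y0"
    and eq: "u * to_ac x + r = (u * to_ac x0 + r) ^ (CARD('q) ^ i)"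
    by (cases Q) (auto simp: \<phi> Fr_funpow)
  have "i > 0"
  proof (rule ccontr)
    assume "\<not> i > 0"
    then have "map_point to_ac (Aff x y) = map_point to_ac Q" using i by simp
    then show False using Q(2) Q0 by simp
  qed
  let ?h = "\<lambda>c. to_ac (const_ratfun c)"
  show False
    by (rule descent[of "?h b" "?h c" "?h a1" "?h a3" "?h a2" "?h a4" "?h a6" u v e r s w i x0])
      (use bc nz \<open>i > 0\<close> eq weq in \<open>simp_all add: E1 const_power_card, simp_all add: const_ratfun_def\<close>)
qed (use assms in auto)

subsection \<open>The two twists\<close>

lemma elliptic_quadratic_twist:
  assumes "(2 :: 'a::field) \<noteq> 0" "d \<noteq> 0"
  shows "elliptic (Curve d 0 0 1 0 (- 1) 0 :: 'a curve)"
proof -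
  have two: "(2 :: 'a alg_closure) \<noteq> 0" using assms by (metis to_ac_eq_0_iff to_ac_numeral)
  have False if "x ^ 3 = x" "3 * x\<^sup>2 = 1" for x :: "'a alg_closure"
  proof -
    \<comment> \<open>This combination of the cubic and its derivative forces a double root to be 0,
      where the derivative does not vanish.\<close>
    have "2 * x = (3 * x\<^sup>2 * x - x) - 3 * (x ^ 3 - x)"
      by (simp add: power2_eq_square power3_eq_cube algebra_simps)
    also have "\<dots> = 0" by (simp add: that)
    finally show False using two that by simp
  qed
  then show ?thesis using assms two
    by (auto simp: elliptic_def Let_def)
qed

lemma elliptic_cubic_twist:
  assumes "(3 :: 'a::field) \<noteq> 0" "d \<noteq> 0"
  shows "elliptic (Curve 1 0 (- 1) d 0 0 0 :: 'a curve)"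
proof -
  have three: "(3 :: 'a alg_closure) \<noteq> 0" using assms by (metis to_ac_eq_0_iff to_ac_numeral)
  have False if "y\<^sup>2 = y" "2 * y = 1" for y :: "'a alg_closure"
  proof -
    have "1 = (2 * y - 1)\<^sup>2 - 4 * (y\<^sup>2 - y)"
      by (simp add: algebra_simps power2_eq_square)
    also have "\<dots> = 0" by (simp add: that)
    finally show False by simp
  qed
  then show ?thesis using assms three
    by (auto simp: elliptic_def Let_def)
qed

lemma const_ratfun_simps [simp]:
  "const_ratfun 0 = 0" "const_ratfun 1 = 1" "const_ratfun (- c) = - const_ratfun c"
  by (simp_all add: const_ratfun_def flip: one_pCons to_fract_uminus)

lemma isotrivial_quadratic_twist:
  assumes "(2 :: 'q::field) \<noteq> 0" "(2 :: 'q ratfun) \<noteq> 0" "d \<noteq> 0"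
  shows "isotrivial (Curve d 0 0 1 0 (- 1) 0 :: 'q ratfun curve)"
proof -
  \<comment> \<open>A square root of \<open>d\<close> rescales \<open>y\<close> and removes the
    twist.\<close>
  obtain v where v: "v\<^sup>2 = to_ac d" using nth_root_exists[of 2 "to_ac d"] by auto
  then have "v \<noteq> 0" using assms by auto
  have "curve_iso (map_curve to_ac (Curve d 0 0 1 0 (- 1) 0))
      (map_curve (\<lambda>c. to_ac (const_ratfun c)) (Curve 1 0 0 1 0 (- 1) 0 :: 'q curve)) (affine_change 1 0 v 0 0)"
    unfolding curve_iso_def
    by (rule exI[of _ 1], rule exI[of _ 0], rule exI[of _ v], rule exI[of _ 0],
        rule exI[of _ 0], rule exI[of _ 1])
      (use \<open>v \<noteq> 0\<close> in \<open>simp add: v power_mult_distrib\<close>)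
  moreover have "elliptic (Curve d 0 0 1 0 (- 1) 0 :: 'q ratfun curve)" "elliptic (Curve 1 0 0 1 0 (- 1) 0 :: 'q curve)"
    using elliptic_quadratic_twist assms one_neq_zero by blast+
  ultimately show ?thesis
    unfolding isotrivial_def trivializes_def by (intro conjI exI)
qed

lemma isotrivial_cubic_twist:
  assumes "(3 :: 'q::field) \<noteq> 0" "(3 :: 'q ratfun) \<noteq> 0" "d \<noteq> 0"
  shows "isotrivial (Curve 1 0 (- 1) d 0 0 0 :: 'q ratfun curve)"
proof -
  \<comment> \<open>Here a cube root of \<open>d\<close> rescales \<open>x\<close>.\<close>
  obtain u where u: "u ^ 3 = to_ac d" using nth_root_exists[of 3 "to_ac d"] by auto
  then have "u \<noteq> 0" using assms by auto
  have "curve_iso (map_curve to_ac (Curve 1 0 (- 1) d 0 0 0))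
      (map_curve (\<lambda>c. to_ac (const_ratfun c)) (Curve 1 0 (- 1) 1 0 0 0 :: 'q curve)) (affine_change u 0 1 0 0)"
    unfolding curve_iso_def
    by (rule exI[of _ u], rule exI[of _ 0], rule exI[of _ 1], rule exI[of _ 0],
        rule exI[of _ 0], rule exI[of _ 1])
      (use \<open>u \<noteq> 0\<close> in \<open>simp add: u power_mult_distrib\<close>)
  moreover have "elliptic (Curve 1 0 (- 1) d 0 0 0 :: 'q ratfun curve)" "elliptic (Curve 1 0 (- 1) 1 0 0 0 :: 'q curve)"
    using elliptic_cubic_twist assms one_neq_zero by blast+
  ultimately show ?thesis
    unfolding isotrivial_def trivializes_def by (intro conjI exI)
qed

lemma separable_point_quadratic_twist:
  fixes F G D :: "'q::{field,finite} poly"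
  assumes card: "CARD('q) = q" "primepow q" and "coprime 2 q"
    and "D \<noteq> 0" and F: "pderiv F \<noteq> 0" and curve: "D * G\<^sup>2 = F ^ 3 - F"
  shows "separable_point (Curve (to_fract D) 0 0 1 0 (- 1) 0) (Aff (to_fract F) (to_fract G))"
proof -
  interpret frobenius_closure q "TYPE('q ratfun_closure)"
    by (rule frobenius_closure_card[OF card])
  note two = numeral_neq_0_if_coprime_card[OF card(1) \<open>coprime 2 q\<close>]
  show ?thesis
  proof (rule separable_pointI)
    show "isotrivial (Curve (to_fract D) 0 0 1 0 (- 1) 0)"
      using \<open>D \<noteq> 0\<close> by (intro isotrivial_quadratic_twist two) simp_all
    have "to_fract (D * G\<^sup>2) = to_fract (F ^ 3 - F)" using curve by simp
    then show "Aff (to_fract F) (to_fract G) \<in> points (Curve (to_fract D) 0 0 1 0 (- 1) 0)"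
      by (simp add: points_def to_fract_power)
    show "\<not> constant_point (Aff (to_fract F) (to_fract G))"
      using F by (auto simp: constant_point_def const_ratfun_def pderiv_pCons)
    fix b a1 a3 c a2 a4 a6 u r v s w e :: "'q ratfun_closure" and x0 i
    assume bc: "b \<noteq> 0" "c \<noteq> 0" and fixed: "\<forall>z\<in>{b, a1, a3, c, a2, a4, a6}. z ^ CARD('q) = z"
      and nz: "u \<noteq> 0" "v \<noteq> 0" "e \<noteq> 0"
      and weq: "\<And>x y. weq (Curve b a1 a3 c a2 a4 a6) (u * x + r) (v * y + s * x + w)
          = e * weq (map_curve to_ac (Curve (to_fract D) 0 0 1 0 (- 1) 0)) x y"
      and i: "i > 0" and eq: "u * to_ac (to_fract F) + r = (u * to_ac x0 + r) ^ (CARD('q) ^ i)"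
    have algs: "alg b" "alg a1" "alg a3" "alg c" "alg a2" "alg a4" "alg a6"
      using fixed alg_fixed unfolding card(1) by auto
    note coeffs = weq_affine_change_coeffs[OF infinite_UNIV_ratfun_closure weq[unfolded curve.map]]
    \<comment> \<open>The 2-torsion points \<open>(r, w)\<close> and \<open>(u + r, s + w)\<close> are the images of \<open>(0, 0)\<close> and \<open>(1, 0)\<close>.\<close>
    have s: "2 * b * s + a1 * u = 0"
    proof -
      have "v * (2 * b * s + a1 * u) = 0" using coeffs(2) by (simp add: algebra_simps)
      then show ?thesis using nz by simp
    qed
    have w: "2 * b * w + a1 * r + a3 = 0"
    proof -
      have "v * (2 * b * w + a1 * r + a3) = 0" using coeffs(3) by (simp add: algebra_simps)
      then show ?thesis using nz by simp
    qed
    have r: "alg r"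
    proof (rule two_torsion_alg[OF algs bc two])
      show "weq (Curve b a1 a3 c a2 a4 a6) r w = 0" using coeffs(7) by simp
      show "weq_dy (Curve b a1 a3 c a2 a4 a6) r w = 0" using w by simp
    qed simp
    have "alg (u + r)"
    proof (rule two_torsion_alg[OF algs bc two])
      show "weq (Curve b a1 a3 c a2 a4 a6) (u + r) (s + w) = 0" using weq[of 1 0] by simp
      have "weq_dy (Curve b a1 a3 c a2 a4 a6) (u + r) (s + w)
          = (2 * b * s + a1 * u) + (2 * b * w + a1 * r + a3)"
        by (simp add: algebra_simps)
      then show "weq_dy (Curve b a1 a3 c a2 a4 a6) (u + r) (s + w) = 0" using s w by simp
    qed simp
    then have u: "alg u" using alg_diff[of "u + r" r] r by simp
    have "u * to_ac (to_fract F) + r = u ^ (q ^ i) * to_ac x0 ^ (q ^ i) + r ^ (q ^ i)"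
      using eq by (simp only: card(1) add_pow power_mult_distrib)
    then have "to_ac (to_fract F) = u ^ (q ^ i) / u * to_ac (x0 ^ (q ^ i)) + (r ^ (q ^ i) - r) / u"
      using nz(1) by (simp add: field_simps)
    also have "x0 ^ (q ^ i) = (x0 ^ (q ^ (i - 1))) ^ q" using i by (rule power_pow_pred)
    finally have "\<exists>w. to_fract F = w ^ q"
      by (rule qth_power_descent[rotated 2]) (intro alg_closed u r)+
    then show False using pderiv_eq_0_if_qth_power[OF card(1)] F by blast
  qed
qed

text \<open>The derivative hypothesis concerns \<open>G\<^sup>2 - G\<close> because the descent only
  makes \<open>D * F ^ 3\<close>, not \<open>F\<close>, a \<open>q\<close>-th power.\<close>

lemma separable_point_cubic_twist:
  fixes F G D :: "'q::{field,finite} poly"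
  assumes card: "CARD('q) = q" "primepow q" and "coprime 3 q"
    and "\<not> 3 dvd degree D" and "F \<noteq> 0" and G: "pderiv (G\<^sup>2 - G) \<noteq> 0" and curve: "G\<^sup>2 - G = D * F ^ 3"
  shows "separable_point (Curve 1 0 (- 1) (to_fract D) 0 0 0) (Aff (to_fract F) (to_fract G))"
proof -
  interpret frobenius_closure q "TYPE('q ratfun_closure)"
    by (rule frobenius_closure_card[OF card])
  note three = numeral_neq_0_if_coprime_card[OF card(1) \<open>coprime 3 q\<close>]
  have "D \<noteq> 0" using assms(4) by auto
  have curve': "to_fract D * to_fract F ^ 3 = to_fract (G\<^sup>2 - G)"
    unfolding curve by (simp add: to_fract_power)
  show ?thesis
  proof (rule separable_pointI)
    show "isotrivial (Curve 1 0 (- 1) (to_fract D) 0 0 0)"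
      using \<open>D \<noteq> 0\<close> by (intro isotrivial_cubic_twist three) simp_all
    show "Aff (to_fract F) (to_fract G) \<in> points (Curve 1 0 (- 1) (to_fract D) 0 0 0)"
      using curve' by (simp add: points_def to_fract_power)
    have "pderiv G \<noteq> 0" using G by (auto simp: pderiv_diff pderiv_power)
    then show "\<not> constant_point (Aff (to_fract F) (to_fract G))"
      by (auto simp: constant_point_def const_ratfun_def pderiv_pCons)
    fix b a1 a3 c a2 a4 a6 u r v s w e :: "'q ratfun_closure" and x0 i
    assume bc: "b \<noteq> 0" "c \<noteq> 0" and fixed: "\<forall>z\<in>{b, a1, a3, c, a2, a4, a6}. z ^ CARD('q) = z"
      and nz: "u \<noteq> 0" "v \<noteq> 0" "e \<noteq> 0"
      and weq: "\<And>x y. weq (Curve b a1 a3 c a2 a4 a6) (u * x + r) (v * y + s * x + w)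
          = e * weq (map_curve to_ac (Curve 1 0 (- 1) (to_fract D) 0 0 0)) x y"
      and i: "i > 0" and eq: "u * to_ac (to_fract F) + r = (u * to_ac x0 + r) ^ (CARD('q) ^ i)"
    have algs: "alg b" "alg a1" "alg a3" "alg c" "alg a2" "alg a4" "alg a6"
      using fixed alg_fixed unfolding card(1) by auto
    note coeffs = weq_affine_change_coeffs[OF infinite_UNIV_ratfun_closure weq[unfolded curve.map]]
    \<comment> \<open>The point \<open>(r, w)\<close> is the image of the flex \<open>(0, 0)\<close>, whose tangent is \<open>y = 0\<close>.\<close>
    define \<mu> where "\<mu> = s / u"
    have s: "s = \<mu> * u" using nz by (simp add: \<mu>_def)
    have slope: "2 * b * \<mu> + a1 = 0"
    proof -
      have "u * v * (2 * b * \<mu> + a1) = 0" using coeffs(2) by (simp add: s algebra_simps)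
      then show ?thesis using nz by simp
    qed
    have l2: "b * \<mu>\<^sup>2 + a1 * \<mu> - 3 * c * r - a2 = 0"
    proof -
      have "u\<^sup>2 * (b * \<mu>\<^sup>2 + a1 * \<mu> - 3 * c * r - a2) = 0"
        using coeffs(5) by (simp add: s algebra_simps power2_eq_square)
      then show ?thesis using nz by simp
    qed
    have l1: "2 * b * \<mu> * w + a1 * (r * \<mu> + w) + a3 * \<mu> - 3 * c * r\<^sup>2 - 2 * a2 * r - a4 = 0"
    proof -
      have "u * (2 * b * \<mu> * w + a1 * (r * \<mu> + w) + a3 * \<mu> - 3 * c * r\<^sup>2 - 2 * a2 * r - a4) = 0"
        using coeffs(6) by (simp add: s algebra_simps)
      then show ?thesis using nz by simp
    qed
    have l0: "weq (Curve b a1 a3 c a2 a4 a6) r w = 0" using coeffs(7) by simp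
    have rw: "alg r" "alg w"
      using flex_alg[OF algs bc three l0 l1 l2 slope] by simp_all
    \<comment> \<open>The twist has opposite coefficients at y^2 and y, so adding the two relations
      eliminates \<open>e\<close> and determines \<open>v\<close>.\<close>
    have "v * (2 * b * w + a1 * r + a3 + b * v) = 0"
      using coeffs(1,3) by (simp add: algebra_simps power2_eq_square)
    then have "b * v = - (2 * b * w + a1 * r + a3)"
      using nz minus_unique[of "2 * b * w + a1 * r + a3" "b * v"] by simp
    then have "v = - (2 * b * w + a1 * r + a3) / b"
      using bc by (simp add: eq_divide_eq mult.commute)
    then have "alg v" using algs rw by (auto intro!: alg_closed)
    have e: "e = b * v\<^sup>2" using coeffs(1) by simp
    have "\<exists>w. to_fract D * to_fract F ^ 3 = w ^ q"
    proof (rule cube_twist_descent[OF \<open>alg r\<close> _ _ eq[unfolded card(1)] i nz(1)])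
      show "alg (e / c)" unfolding e using algs \<open>alg v\<close> by (intro alg_closed)
      show "u ^ 3 = e / c * to_ac (to_fract D)" using coeffs(4) bc by (simp add: field_simps)
      show "to_fract F \<noteq> 0" using \<open>F \<noteq> 0\<close> by simp
      show "\<not> 3 dvd q"
      proof
        assume "3 dvd q"
        then have "3 dvd (1 :: nat)" using \<open>coprime 3 q\<close> by (metis coprime_common_divisor dvd_refl)
        then show False by simp
      qed
      show "(to_fract D * g ^ 3) ^ (q ^ M) \<noteq> to_fract D * g ^ 3" if "g \<noteq> 0" "M > 0" for g M
        using that one_less_power[OF q_gt_1] \<open>D \<noteq> 0\<close> assms(4) by (intro not_constant_times_cube)
    qed
    then show False using pderiv_eq_0_if_qth_power[OF card(1)] G curve' by metis
  qed
qed

subsection \<open>The points\<close>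

text \<open>\<open>T\<close> is the polynomial of the trace from \<open>GF(q^n)\<close> to \<open>GF(q^k)\<close>.\<close>

lemma exists_trace_polynomial:
  assumes card: "CARD('q::{field,finite}) = q" "primepow q" and "k > 0" "k dvd n" "n > 0"
  obtains T :: "'q::{field,finite} poly"
  where "T ^ (q ^ k) - T = [:0, 1:] ^ (q ^ n) - [:0, 1:]" "pderiv T = 1"
proof -
  obtain m where m: "n = k * m" using assms by (auto simp: dvd_def)
  define f where "f = (\<lambda>i. [:0, 1 :: 'q:] ^ (q ^ (k * i)))"
  define T where "T = (\<Sum>i<m. f i)"
  obtain l where l: "prime CHAR('q)" "q = CHAR('q) ^ l"
    using primepow_card_CHAR card by blast
  have "T ^ (q ^ k) = (\<Sum>i<m. f i ^ (q ^ k))"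
    unfolding T_def by (rule freshmans_dream_sum'[of _ "l * k"]) (use l in \<open>simp_all add: power_mult\<close>)
  also have "\<dots> = (\<Sum>i<m. f (Suc i))"
    by (simp add: f_def power_add mult.commute flip: power_mult)
  finally have "T ^ (q ^ k) - T = (\<Sum>i<m. f (Suc i) - f i)"
    by (simp add: T_def sum_subtractf)
  also have "\<dots> = f m - f 0" by (rule sum_lessThan_telescope)
  finally have T: "T ^ (q ^ k) - T = [:0, 1:] ^ (q ^ n) - [:0, 1:]"
    by (simp add: f_def m)
  \<comment> \<open>Both large exponents are multiples of \<open>q\<close>, so differentiation
    leaves only the linear terms.\<close>
  then have "pderiv (T ^ (q ^ k) - T) = pderiv ([:0, 1:] ^ (q ^ n) - [:0, 1:])" by simp
  moreover have "q dvd q ^ k" "q dvd q ^ n" using assms by simp_all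
  ultimately have "pderiv T = pderiv [:0, 1:]"
    by (simp add: pderiv_diff pderiv_power_card[OF card(1)])
  then show ?thesis using T that by (simp add: pderiv_pCons one_pCons)
qed

text \<open>Since \<open>q * q\<close> is 1 modulo \<open>c\<close>, an odd power of
  \<open>q\<close> stays in the class of \<open>q\<close>; this makes the exponents of the points
  integers.\<close>

lemma odd_power_mod:
  fixes q c k :: nat
  assumes "q * q mod c = 1" "odd k"
  shows "q ^ k mod c = q mod c"
proof -
  obtain j where j: "k = 2 * j + 1" using assms(2) by (auto elim: oddE)
  have "(q * q) ^ j mod c = 1 mod c"
    using power_mod[of "q * q" c j] assms(1) by simp
  then have "q * (q * q) ^ j mod c = q mod c"
    by (metis mod_mult_right_eq mult.right_neutral)
  then show ?thesis by (simp add: j power_mult power2_eq_square)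
qed

lemma of_nat_power_card_minus_1:
  assumes "CARD('q::{field,finite}) = q" "k > 0" "q ^ k = Suc m"
  shows "of_nat m = (- 1 :: 'q)"
proof -
  have "of_nat (q ^ k) = (0 :: 'q)" using of_nat_card_eq_0[OF assms(1)] assms(2) by simp
  then show ?thesis unfolding assms(3) by (simp add: eq_neg_iff_add_eq_0 add.commute)
qed

lemma exists_point_quadratic_twist:
  assumes card: "CARD('q::{field,finite}) = q" "primepow q" and "n > 0"
    and q: "q mod 4 = 3" and k: "odd k" "k dvd n"
  shows "\<exists>Q :: 'q ratfun point. separable_point (quadratic_twist_curve q n) Q \<and> infty_integral Q"
proof -
  have "k > 0" using k by (auto intro: Nat.gr0I)
  obtain T :: "'q poly"
    where T: "T ^ (q ^ k) - T = [:0, 1:] ^ (q ^ n) - [:0, 1:]" "pderiv T = 1"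
    using exists_trace_polynomial[OF card \<open>k > 0\<close> \<open>k dvd n\<close> \<open>n > 0\<close>] .
  then have "T \<noteq> 0" by auto
  have "q * q mod 4 = 1" using mod_mult_eq[of q 4 q] q by simp
  then have "q ^ k mod 4 = 3" using odd_power_mod k q by metis
  then obtain j where j: "q ^ k = 4 * j + 3" by (metis mod_div_mult_eq add.commute mult.commute)
  define D where "D = T ^ (q ^ k) - T"
  \<comment> \<open>The equation holds since \<open>q ^ k + 2 * j = 3 * (2 * j + 1)\<close>.\<close>
  let ?F = "T ^ (2 * j + 1)" and ?G = "T ^ j"
  have curve: "D * ?G\<^sup>2 = ?F ^ 3 - ?F"
    by (simp add: D_def j algebra_simps flip: power_mult power_add power_Suc power_Suc2)
  have "separable_point (Curve (to_fract D) 0 0 1 0 (- 1) 0) (Aff (to_fract ?F) (to_fract ?G))"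
  proof (rule separable_point_quadratic_twist[OF card _ _ _ curve])
    show "coprime 2 q" using q by (simp add: coprime_left_2_iff_odd) presburger
    \<comment> \<open>Twice the exponent of \<open>?F\<close> is \<open>q ^ k - 1\<close>, which is
      -1 in the field, so the exponent survives differentiation.\<close>
    have "2 * of_nat (2 * j + 1) = (of_nat (4 * j + 2) :: 'q)" by simp
    also have "\<dots> = - 1" by (rule of_nat_power_card_minus_1[OF card(1) \<open>k > 0\<close>]) (simp add: j)
    finally have "of_nat (2 * j + 1) \<noteq> (0 :: 'q)"
      by (metis mult_zero_right neg_equal_0_iff_equal zero_neq_one)
    then show "pderiv ?F \<noteq> 0" using T(2) \<open>T \<noteq> 0\<close>
      by (subst pderiv_power) (simp del: power_Suc of_nat_Suc of_nat_add of_nat_mult)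
    show "D \<noteq> 0"
    proof
      assume "D = 0"
      then have "pderiv (T ^ (q ^ k) - T) = 0" by (simp add: D_def)
      then show False using T(2) \<open>k > 0\<close> by (simp add: pderiv_diff pderiv_power_card[OF card(1)])
    qed
  qed
  moreover have "quadratic_twist_curve q n = Curve (to_fract D) 0 0 1 0 (- 1) 0"
    by (simp only: quadratic_twist_curve_def twist_factor_def D_def T(1))
  ultimately show ?thesis unfolding infty_integral_def by metis
qed

lemma exists_point_cubic_twist:
  assumes card: "CARD('q::{field,finite}) = q" "primepow q" and "n > 0"
    and q: "q mod 3 = 2" and k: "odd k" "k dvd n"
  shows "\<exists>Q :: 'q ratfun point. separable_point (cubic_twist_curve q n) Q \<and> infty_integral Q"
proof -
  have "k > 0" using k by (auto intro: Nat.gr0I)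
  obtain T :: "'q poly"
    where T: "T ^ (q ^ k) - T = [:0, 1:] ^ (q ^ n) - [:0, 1:]" "pderiv T = 1"
    using exists_trace_polynomial[OF card \<open>k > 0\<close> \<open>k dvd n\<close> \<open>n > 0\<close>] .
  then have "T \<noteq> 0" by auto
  have "q * q mod 3 = 1" using mod_mult_eq[of q 3 q] q by simp
  then have "q ^ k mod 3 = 2" using odd_power_mod k q by metis
  then obtain j where j: "q ^ k = 3 * j + 2" by (metis mod_div_mult_eq add.commute mult.commute)
  have coprime: "coprime 3 q" using q by (subst prime_imp_coprime) auto
  define D where "D = T ^ (q ^ k) - T"
  \<comment> \<open>The equation holds since \<open>q ^ k + 3 * j = 2 * (3 * j + 1)\<close>.\<close>
  let ?F = "T ^ j" and ?G = "T ^ (3 * j + 1)"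
  have curve: "?G\<^sup>2 - ?G = D * ?F ^ 3"
    by (simp add: D_def j algebra_simps flip: power_mult power_add power_Suc power_Suc2)
  have "separable_point (Curve 1 0 (- 1) (to_fract D) 0 0 0) (Aff (to_fract ?F) (to_fract ?G))"
  proof (rule separable_point_cubic_twist[OF card coprime _ _ _ curve])
    show "?F \<noteq> 0" using \<open>T \<noteq> 0\<close> by simp
    have q1: "q > 1" using primepow_gt_Suc_0[OF card(2)] by simp
    have "degree D = q ^ n"
    proof -
      have "degree (([:0, 1 :: 'q:] ^ (q ^ n)) + - [:0, 1:]) = degree ([:0, 1 :: 'q:] ^ (q ^ n))"
        using one_less_power[OF q1 \<open>n > 0\<close>] by (intro degree_add_eq_left) (simp add: degree_power_eq)
      moreover have "D = [:0, 1:] ^ (q ^ n) + - [:0, 1:]"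
        unfolding D_def T(1) by (rule diff_conv_add_uminus)
      ultimately have "degree D = degree ([:0, 1 :: 'q:] ^ (q ^ n))" by (simp only:)
      then show ?thesis by (simp add: degree_power_eq)
    qed
    moreover have "\<not> 3 dvd q" using q by presburger
    ultimately show "\<not> 3 dvd degree D" using prime_dvd_power[of 3 q n] by auto
    have m1: "of_nat (3 * j + 1) = (- 1 :: 'q)"
      by (rule of_nat_power_card_minus_1[OF card(1) \<open>k > 0\<close>]) (simp add: j)
    have G': "pderiv ?G = - (T ^ (3 * j))"
      using T(2) m1 by (subst pderiv_power) (simp del: power_Suc of_nat_Suc of_nat_add of_nat_mult)
    have "pderiv (?G\<^sup>2 - ?G) = T ^ (3 * j) * (1 - 2 * ?G)"
      unfolding power2_eq_square pderiv_diff pderiv_mult G' by (simp add: algebra_simps)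
    moreover have "1 - 2 * ?G \<noteq> 0"
    proof
      assume "1 - 2 * ?G = 0"
      \<comment> \<open>Otherwise \<open>T\<close> would be a unit, hence constant, contrary to
        \<open>pderiv T = 1\<close>.\<close>
      then have "1 = T * (2 * T ^ (3 * j))" by (simp add: algebra_simps)
      then have "T dvd 1" by (rule dvdI)
      then obtain t where "T = [:t:]" by (meson is_unit_polyE)
      then show False using T(2) by (simp add: pderiv_pCons)
    qed
    ultimately show "pderiv (?G\<^sup>2 - ?G) \<noteq> 0" using \<open>T \<noteq> 0\<close> by simp
  qed
  moreover have "cubic_twist_curve q n = Curve 1 0 (- 1) (to_fract D) 0 0 0"
    by (simp only: cubic_twist_curve_def twist_factor_def D_def T(1))
  ultimately show ?thesis unfolding infty_integral_def by metis
qed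

theorem mainTheorem1:
  fixes q n :: nat
  assumes "CARD('q::{field,finite}) = q" and "primepow q" and "n > 0"
  shows "(q mod 4 = 3 \<longrightarrow>
            (\<forall>k. odd k \<and> k > 0 \<and> k dvd n \<longrightarrow>
               (\<exists>Q :: 'q ratfun point.
                  separable_point (quadratic_twist_curve q n) Q \<and> infty_integral Q))) \<and>
         (q mod 3 = 2 \<longrightarrow>
            (\<forall>k. odd k \<and> k > 0 \<and> k dvd n \<longrightarrow>
               (\<exists>Q :: 'q ratfun point.
                  separable_point (cubic_twist_curve q n) Q \<and> infty_integral Q)))"
  using exists_point_quadratic_twist[OF assms] exists_point_cubic_twist[OF assms] by blast

end
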